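(* Let $({\mathcal H},\pi)$ be any permutative representation of the Cuntz algebra ${\mathcal O}_{\infty}$, with reference subspace ${\mathcal D}$. Define the family $\{A_{n}:n\in{\mathbf N}\}$ of operators on ${\mathcal D}$ by $$A_{1}v\equiv \sum_{m=1}^{\infty}\sqrt{m}\,\pi(s_{m}s_{m+1}^{*})v,$$ $$A_{n}v\equiv \sum_{m_{n-1}=1}^{\infty}\cdots\sum_{m_{1}=1}^{\infty}\sum_{m=1}^{\infty}\sqrt{m}\,\pi(s_{m_{n-1}}\cdots s_{m_{1}}s_{m}s_{m+1}^{*}s_{m_{1}}^{*}\cdots s_{m_{n-1}}^{*})v\qquad(n\geq 2)$$ for $v\in{\mathcal D}$. Then the family $\{A_{n}:n\in{\mathbf N}\}$ satisfies on ${\mathcal D}$ the relations $$A_{n}A_{m}^{*}-A_{m}^{*}A_{n}=\delta_{nm}I,\qquad A_{n}A_{m}-A_{m}A_{n}=A_{n}^{*}A_{m}^{*}-A_{m}^{*}A_{n}^{*}=0\qquad(n,m\in{\mathbf N}).$$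
   Context: ${\mathbf N}=\{1,2,3,\ldots\}$. ${\mathcal O}_{\infty}$ is the Cuntz algebra, i.e. the unital C$^{*}$-algebra universally generated by $\{s_{n}:n\in{\mathbf N}\}$ (the canonical generators) satisfying $s_{i}^{*}s_{j}=\delta_{ij}I$ for $i,j\in{\mathbf N}$ and $\sum_{i=1}^{k}s_{i}s_{i}^{*}\leq I$ for every $k\in{\mathbf N}$. A representation $({\mathcal H},\pi)$ of ${\mathcal O}_{\infty}$ is permutative if there exist a complete orthonormal basis $\{e_{n}\}_{n\in\Lambda}$ of ${\mathcal H}$ and a family $f=\{f_{i}\}_{i=1}^{\infty}$ of maps on $\Lambda$ such that $\pi(s_{i})e_{n}=e_{f_{i}(n)}$ for each $n\in\Lambda$ and $i\in{\mathbf N}$. The basis $\{e_{n}\}_{n\in\Lambda}$ is called the reference basis, and its (algebraic) linear hull ${\mathcal D}$ is called the reference subspace of $({\mathcal H},\pi)$. For each $v\in{\mathcal D}$ the infinite sums defining $A_{n}v$ are actually finite. $A_{n}^{*}$ denotes the $*$-conjugate of $A_{n}$ as an operator on ${\mathcal D}$, i.e. the Hilbert space adjoint restricted to ${\mathcal D}$.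
   Formalization: For n=m, A_nA_n^*-A_n^*A_n=I is claimed only if every point of Λ lies in the range of some f_i; without this it fails (in the Fock representation on words, f_i(w)=iw, all A_n and A_n^* kill the vacuum). All other relations hold for any permutative representation. *)

theory Defs
  imports "HOL-Analysis.Analysis" "HOL-Algebra.Module"
begin

section \<open>Complex Hilbert spaces\<close>

text \<open>The inner product is antilinear in the first argument.\<close>

class complex_inner = real_normed_vector +
  fixes scaleC :: "complex \<Rightarrow> 'a \<Rightarrow> 'a"  (infixr "*\<^sub>C" 75)
    and cinner :: "'a \<Rightarrow> 'a \<Rightarrow> complex"
  assumes scaleC_add_right: "c *\<^sub>C (x + y) = c *\<^sub>C x + c *\<^sub>C y"
    and scaleC_add_left: "(c + d) *\<^sub>C x = c *\<^sub>C x + d *\<^sub>C x"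
    and scaleC_scaleC: "c *\<^sub>C d *\<^sub>C x = (c * d) *\<^sub>C x"
    and scaleR_scaleC: "scaleR r x = complex_of_real r *\<^sub>C x"
    and cinner_commute: "cinner x y = cnj (cinner y x)"
    and cinner_add_left: "cinner (x + y) z = cinner x z + cinner y z"
    and cinner_scaleC_left: "cinner (c *\<^sub>C x) y = cnj c * cinner x y"
    and cinner_self: "cinner x x = complex_of_real ((norm x)\<^sup>2)"

class chilbert_space = complex_inner + complete_space

instantiation complex :: chilbert_space
begin
definition "scaleC (c::complex) (x::complex) = c * x"
definition "cinner (x::complex) (y::complex) = cnj x * y"
instance
proof
  fix x :: complex
  show "cinner x x = complex_of_real ((norm x)\<^sup>2)"
    by (metis cinner_complex_def complex_norm_square mult.commute)
qed (auto simp: scaleC_complex_def cinner_complex_def algebra_simps scaleR_conv_of_real)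
end

abbreviation cspan :: "'h::complex_inner set \<Rightarrow> 'h set"
  where "cspan \<equiv> Modules.module.span scaleC"

definition bounded_clinear :: "('h::complex_inner \<Rightarrow> 'h) \<Rightarrow> bool"
  where "bounded_clinear T \<longleftrightarrow> bounded_linear T \<and> (\<forall>c x. T (c *\<^sub>C x) = c *\<^sub>C T x)"

text \<open>The Hilbert space adjoint of an operator \<open>T\<close> with (dense) domain \<open>D\<close>; meaningful at
  those \<open>y\<close> for which a representing vector \<open>z\<close> exists.\<close>

definition adjoint_on :: "'h::complex_inner set \<Rightarrow> ('h \<Rightarrow> 'h) \<Rightarrow> 'h \<Rightarrow> 'h"
  where "adjoint_on D T y = (THE z. \<forall>x\<in>D. cinner (T x) y = cinner x z)"

definition complete_orthonormal_basis :: "'i set \<Rightarrow> ('i \<Rightarrow> 'h::complex_inner) \<Rightarrow> bool"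
  where "complete_orthonormal_basis \<Lambda> e \<longleftrightarrow>
    (\<forall>x\<in>\<Lambda>. \<forall>y\<in>\<Lambda>. cinner (e x) (e y) = (if x = y then 1 else 0)) \<and>
    closure (cspan (e ` \<Lambda>)) = UNIV"


section \<open>Unital C*-algebras\<close>

definition complex_ring :: "complex ring"
  where "complex_ring = \<lparr>carrier = UNIV, mult = (*), one = 1, zero = 0, add = (+)\<rparr>"

record 'a cstar = "(complex, 'a) module" +
  star :: "'a \<Rightarrow> 'a"
  nrm :: "'a \<Rightarrow> real"

locale unital_cstar_algebra = ring A + Module.module complex_ring A for A (structure) +
  assumes smult_mult_left: "\<lbrakk>x \<in> carrier A; y \<in> carrier A\<rbrakk> \<Longrightarrow> (c \<odot> x) \<otimes> y = c \<odot> (x \<otimes> y)"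
    and smult_mult_right: "\<lbrakk>x \<in> carrier A; y \<in> carrier A\<rbrakk> \<Longrightarrow> x \<otimes> (c \<odot> y) = c \<odot> (x \<otimes> y)"
    and star_closed: "x \<in> carrier A \<Longrightarrow> star A x \<in> carrier A"
    and star_star: "x \<in> carrier A \<Longrightarrow> star A (star A x) = x"
    and star_add: "\<lbrakk>x \<in> carrier A; y \<in> carrier A\<rbrakk> \<Longrightarrow> star A (x \<oplus> y) = star A x \<oplus> star A y"
    and star_smult: "x \<in> carrier A \<Longrightarrow> star A (c \<odot> x) = cnj c \<odot> star A x"
    and star_mult: "\<lbrakk>x \<in> carrier A; y \<in> carrier A\<rbrakk> \<Longrightarrow> star A (x \<otimes> y) = star A y \<otimes> star A x"
    and nrm_nonneg: "x \<in> carrier A \<Longrightarrow> 0 \<le> nrm A x"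
    and nrm_eq_0_iff: "x \<in> carrier A \<Longrightarrow> nrm A x = 0 \<longleftrightarrow> x = \<zero>"
    and nrm_add: "\<lbrakk>x \<in> carrier A; y \<in> carrier A\<rbrakk> \<Longrightarrow> nrm A (x \<oplus> y) \<le> nrm A x + nrm A y"
    and nrm_smult: "x \<in> carrier A \<Longrightarrow> nrm A (c \<odot> x) = cmod c * nrm A x"
    and nrm_mult: "\<lbrakk>x \<in> carrier A; y \<in> carrier A\<rbrakk> \<Longrightarrow> nrm A (x \<otimes> y) \<le> nrm A x * nrm A y"
    and cstar_identity: "x \<in> carrier A \<Longrightarrow> nrm A (star A x \<otimes> x) = (nrm A x)\<^sup>2"
    and nrm_complete: "\<lbrakk>\<And>n. X n \<in> carrier A;
        \<And>\<epsilon>. \<epsilon> > 0 \<Longrightarrow> \<exists>N::nat. \<forall>m\<ge>N. \<forall>n\<ge>N. nrm A (X m \<ominus> X n) < \<epsilon>\<rbrakk>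
      \<Longrightarrow> \<exists>x\<in>carrier A. (\<lambda>n. nrm A (X n \<ominus> x)) \<longlonglongrightarrow> 0"

definition cstar_le :: "'a cstar \<Rightarrow> 'a \<Rightarrow> 'a \<Rightarrow> bool"
  where "cstar_le A x y \<longleftrightarrow> (\<exists>b\<in>carrier A. y \<ominus>\<^bsub>A\<^esub> x = star A b \<otimes>\<^bsub>A\<^esub> b)"

definition unital_star_hom :: "'a cstar \<Rightarrow> 'b cstar \<Rightarrow> ('a \<Rightarrow> 'b) \<Rightarrow> bool"
  where "unital_star_hom A B \<phi> \<longleftrightarrow> \<phi> \<in> ring_hom A B \<and>
    (\<forall>x\<in>carrier A. (\<forall>c. \<phi> (c \<odot>\<^bsub>A\<^esub> x) = c \<odot>\<^bsub>B\<^esub> \<phi> x) \<and> \<phi> (star A x) = star B (\<phi> x))"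

definition closed_star_subalgebra :: "'a set \<Rightarrow> 'a cstar \<Rightarrow> bool"
  where "closed_star_subalgebra C A \<longleftrightarrow> C \<subseteq> carrier A \<and> \<zero>\<^bsub>A\<^esub> \<in> C \<and>
    (\<forall>x\<in>C. \<forall>y\<in>C. x \<oplus>\<^bsub>A\<^esub> y \<in> C \<and> x \<otimes>\<^bsub>A\<^esub> y \<in> C) \<and>
    (\<forall>x\<in>C. (\<forall>c. c \<odot>\<^bsub>A\<^esub> x \<in> C) \<and> star A x \<in> C) \<and>
    (\<forall>X. \<forall>x\<in>carrier A. (\<forall>n::nat. X n \<in> C) \<and> (\<lambda>n. nrm A (X n \<ominus>\<^bsub>A\<^esub> x)) \<longlonglongrightarrow> 0 \<longrightarrow> x \<in> C)"


section \<open>The Cuntz algebra on infinitely many generators\<close>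

text \<open>The generators are indexed by the positive integers; \<open>s 0\<close> is irrelevant.\<close>

definition cuntz_relations :: "'a cstar \<Rightarrow> (nat \<Rightarrow> 'a) \<Rightarrow> bool"
  where "cuntz_relations A s \<longleftrightarrow>
    (\<forall>i\<ge>1. s i \<in> carrier A) \<and>
    (\<forall>i\<ge>1. \<forall>j\<ge>1. star A (s i) \<otimes>\<^bsub>A\<^esub> s j = (if i = j then \<one>\<^bsub>A\<^esub> else \<zero>\<^bsub>A\<^esub>)) \<and>
    (\<forall>k\<ge>1. cstar_le A (\<Oplus>\<^bsub>A\<^esub>i\<in>{1..k}. s i \<otimes>\<^bsub>A\<^esub> star A (s i)) \<one>\<^bsub>A\<^esub>)"

text \<open>\<open>A\<close> is the Cuntz algebra with canonical generators \<open>s\<close>: the relations hold, \<open>s\<close> generates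
  \<open>A\<close> as a C*-algebra, and \<open>A\<close> is universal with these properties. Testing universality on
  algebras carried by sets of reals is no restriction: in any target only the C*-subalgebra
  generated by the countable family \<open>t\<close> matters, and this has at most continuum many elements.\<close>

definition is_cuntz_algebra_infty :: "'a cstar \<Rightarrow> (nat \<Rightarrow> 'a) \<Rightarrow> bool"
  where "is_cuntz_algebra_infty A s \<longleftrightarrow>
    unital_cstar_algebra A \<and> cuntz_relations A s \<and>
    (\<forall>C. closed_star_subalgebra C A \<and> s ` {1..} \<subseteq> C \<longrightarrow> C = carrier A) \<and>
    (\<forall>(B :: real cstar) t. unital_cstar_algebra B \<and> cuntz_relations B t \<longrightarrow>
      (\<exists>\<phi>. unital_star_hom A B \<phi> \<and> (\<forall>i\<ge>1. \<phi> (s i) = t i)))"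

text \<open>Representations are star-homomorphisms into the bounded operators. They are not assumed
  to be unital.\<close>

definition representation :: "'a cstar \<Rightarrow> ('a \<Rightarrow> 'h::chilbert_space \<Rightarrow> 'h) \<Rightarrow> bool"
  where "representation A \<pi> \<longleftrightarrow>
    (\<forall>a\<in>carrier A. bounded_clinear (\<pi> a)) \<and>
    (\<forall>a\<in>carrier A. \<forall>b\<in>carrier A. \<forall>v. \<pi> (a \<oplus>\<^bsub>A\<^esub> b) v = \<pi> a v + \<pi> b v) \<and>
    (\<forall>c. \<forall>a\<in>carrier A. \<forall>v. \<pi> (c \<odot>\<^bsub>A\<^esub> a) v = c *\<^sub>C \<pi> a v) \<and>
    (\<forall>a\<in>carrier A. \<forall>b\<in>carrier A. \<forall>v. \<pi> (a \<otimes>\<^bsub>A\<^esub> b) v = \<pi> a (\<pi> b v)) \<and>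
    (\<forall>a\<in>carrier A. \<forall>v w. cinner (\<pi> (star A a) v) w = cinner v (\<pi> a w))"

definition permutative ::
    "(nat \<Rightarrow> 'a) \<Rightarrow> ('a \<Rightarrow> 'h::chilbert_space \<Rightarrow> 'h) \<Rightarrow> 'i set \<Rightarrow> ('i \<Rightarrow> 'h) \<Rightarrow> (nat \<Rightarrow> 'i \<Rightarrow> 'i) \<Rightarrow> bool"
  where "permutative s \<pi> \<Lambda> e f \<longleftrightarrow> complete_orthonormal_basis \<Lambda> e \<and>
    (\<forall>i\<ge>1. \<forall>x\<in>\<Lambda>. f i x \<in> \<Lambda> \<and> \<pi> (s i) (e x) = e (f i x))"


section \<open>The recursive boson system\<close>

definition alg_word :: "'a cstar \<Rightarrow> 'a list \<Rightarrow> 'a"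
  where "alg_word A xs = foldr (\<lambda>x y. x \<otimes>\<^bsub>A\<^esub> y) xs \<one>\<^bsub>A\<^esub>"

text \<open>\<open>iterated_sum k F\<close> is the \<open>k\<close>-fold iterated series over the positive integers of
  \<open>F [j\<^sub>k, \<dots>, j\<^sub>1]\<close>, the outermost index \<open>j\<^sub>k\<close> being the head of the list.\<close>

primrec iterated_sum :: "nat \<Rightarrow> (nat list \<Rightarrow> 'h) \<Rightarrow> 'h::real_normed_vector"
  where "iterated_sum 0 F = F []"
  | "iterated_sum (Suc k) F = (\<Sum>\<^sub>\<infinity>j\<in>{1..}. iterated_sum k (\<lambda>J. F (j # J)))"

definition boson_op ::
    "'a cstar \<Rightarrow> (nat \<Rightarrow> 'a) \<Rightarrow> ('a \<Rightarrow> 'h::chilbert_space \<Rightarrow> 'h) \<Rightarrow> nat \<Rightarrow> 'h \<Rightarrow> 'h"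
  where "boson_op A s \<pi> n v = iterated_sum (n - 1) (\<lambda>J. \<Sum>\<^sub>\<infinity>m\<in>{1..}. sqrt (real m) *\<^sub>R
    \<pi> (alg_word A (map s J @ [s m, star A (s (m + 1))] @ map (\<lambda>j. star A (s j)) (rev J))) v)"


section \<open>Necessity of the covering condition\<close>

text \<open>The Cuntz relations on infinitely many generators do not force the ranges \<open>f i ` \<Lambda>\<close> to cover
  \<open>\<Lambda>\<close>: on the full Fock space over \<open>l\<^sup>2\<close>, with the words in the positive integers as \<open>\<Lambda>\<close> and
  \<open>f i w = i # w\<close>, the vacuum (the empty word) lies in no range, and every boson operator and its
  adjoint annihilate it. Hence the canonical relation for \<open>n = m\<close> needs
  \<open>\<Lambda> = (\<Union>i\<in>{1..}. f i ` \<Lambda>)\<close>, i.e. that \<open>f\<close> is a branching function system on \<open>\<Lambda>\<close>. By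
  \<open>boson_relation_imp_cover\<close> this is necessary already for \<open>n = m = 1\<close>.\<close>

lemma cinner_add_right: "cinner x (y + z) = cinner x y + cinner x (z::'h::complex_inner)"
  by (metis cinner_add_left cinner_commute complex_cnj_add)

lemma cinner_scaleC_right: "cinner x (c *\<^sub>C y) = c * cinner x (y::'h::complex_inner)"
  by (metis cinner_commute cinner_scaleC_left complex_cnj_cnj complex_cnj_mult)

lemma cinner_zero [simp]: "cinner 0 x = 0" "cinner x 0 = 0" for x :: "'h::complex_inner"
  using cinner_add_left[of 0 0 x] cinner_add_right[of x 0 0] by auto

lemma cinner_minus: "cinner (- x) y = - cinner x y" "cinner x (- y) = - cinner x y"
  for x y :: "'h::complex_inner"
  using cinner_add_left[of x "- x" y] cinner_add_right[of x y "- y"]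
  by (auto simp: eq_neg_iff_add_eq_0 add.commute)

lemma cinner_diff: "cinner (x - y) z = cinner x z - cinner y z"
  "cinner z (x - y) = cinner z x - cinner z y" for x y z :: "'h::complex_inner"
  by (simp_all add: diff_conv_add_uminus cinner_add_left cinner_add_right cinner_minus del: add_uminus_conv_diff)

lemma cinner_eq_zero_self: "cinner x x = 0 \<longleftrightarrow> x = (0::'h::complex_inner)"
  by (simp add: cinner_self)

lemma module_scaleC: "Modules.module (scaleC :: complex \<Rightarrow> 'h \<Rightarrow> 'h::complex_inner)"
  by standard (auto simp: scaleC_add_right scaleC_add_left scaleC_scaleC 
      scaleR_scaleC[of 1, simplified, symmetric])

lemma cinner_bound: "cmod (cinner x y) \<le> norm x * norm (y::'h::complex_inner)"
proof (cases "y = 0")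
  case False
  define c where "c = cinner y x / cinner y y"
  have yy: "cinner y y \<noteq> 0" using False by (simp add: cinner_eq_zero_self)
  have "cinner (x - c *\<^sub>C y) y = 0"
    by (simp add: c_def cinner_diff cinner_scaleC_left cinner_self cinner_commute[of x y] False)
  then have "cinner (x - c *\<^sub>C y) (x - c *\<^sub>C y) = cinner (x - c *\<^sub>C y) x"
    by (simp add: cinner_diff cinner_scaleC_right)
  also have "\<dots> = cinner x x - cnj (cinner y x) * cinner y x / cinner y y"
    by (simp add: c_def cinner_diff cinner_scaleC_left cinner_self)
  also have "cnj (cinner y x) * cinner y x = complex_of_real ((cmod (cinner y x))\<^sup>2)"
    by (metis complex_norm_square mult.commute)
  finally have "complex_of_real ((norm (x - c *\<^sub>C y))\<^sup>2) =
      complex_of_real ((norm x)\<^sup>2 - (cmod (cinner y x))\<^sup>2 / (norm y)\<^sup>2)"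
    by (simp add: cinner_self)
  then have "(norm (x - c *\<^sub>C y))\<^sup>2 = (norm x)\<^sup>2 - (cmod (cinner y x))\<^sup>2 / (norm y)\<^sup>2"
    using of_real_eq_iff by blast
  then have "(cmod (cinner y x))\<^sup>2 / (norm y)\<^sup>2 \<le> (norm x)\<^sup>2"
    by (metis diff_ge_0_iff_ge zero_le_power2)
  then have "(cmod (cinner y x))\<^sup>2 \<le> (norm x * norm y)\<^sup>2"
    using False by (simp add: divide_le_eq power_mult_distrib)
  moreover have "cmod (cinner y x) = cmod (cinner x y)"
    by (metis cinner_commute complex_mod_cnj)
  ultimately show ?thesis
    by (metis mult_nonneg_nonneg norm_ge_zero power2_le_imp_le)
qed simp

lemma bounded_linear_cinner_right: "bounded_linear (cinner (x::'h::complex_inner))"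
  by (rule bounded_linear_intro[where K = "norm x"])
    (auto simp: cinner_add_right scaleR_scaleC cinner_scaleC_right scaleC_complex_def,
      metis cinner_bound mult.commute)

lemma orthogonal_basis_zero:
  fixes u :: "'h::complex_inner"
  assumes "complete_orthonormal_basis \<Lambda> e" and "\<And>y. y \<in> \<Lambda> \<Longrightarrow> cinner u (e y) = 0"
  shows "u = 0"
proof -
  have sub: "Modules.module.subspace scaleC {w. cinner u w = 0}"
    unfolding module.subspace_def[OF module_scaleC]
    by (auto simp: cinner_add_right cinner_scaleC_right)
  have "cspan (e ` \<Lambda>) \<subseteq> {w. cinner u w = 0}"
    by (rule module.span_minimal[OF module_scaleC _ sub]) (use assms(2) in auto)
  moreover have "closed {w. cinner u w = 0}"
    by (intro closed_Collect_eq continuous_intros)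
      (simp add: bounded_linear_cinner_right linear_continuous_on)
  ultimately have "closure (cspan (e ` \<Lambda>)) \<subseteq> {w. cinner u w = 0}"
    by (rule closure_minimal)
  then show ?thesis
    using assms(1) cinner_eq_zero_self[of u] by (auto simp: complete_orthonormal_basis_def)
qed

lemma boson_relation_imp_cover:
  fixes \<pi> :: "'a \<Rightarrow> 'h::chilbert_space \<Rightarrow> 'h"
  assumes A: "unital_cstar_algebra A" "cuntz_relations A s" and rep: "representation A \<pi>"
    and perm: "permutative s \<pi> \<Lambda> e f"
    and ccr: "\<And>v. v \<in> cspan (e ` \<Lambda>) \<Longrightarrow>
      boson_op A s \<pi> 1 (adjoint_on (cspan (e ` \<Lambda>)) (boson_op A s \<pi> 1) v) -
      adjoint_on (cspan (e ` \<Lambda>)) (boson_op A s \<pi> 1) (boson_op A s \<pi> 1 v) = v"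
  shows "\<Lambda> = (\<Union>i\<in>{1..}. f i ` \<Lambda>)"
proof (rule ccontr)
  interpret unital_cstar_algebra A by fact
  have onb: "complete_orthonormal_basis \<Lambda> e" using perm by (simp add: permutative_def)
  let ?D = "cspan (e ` \<Lambda>)" and ?a = "boson_op A s \<pi> 1"
  assume "\<Lambda> \<noteq> (\<Union>i\<in>{1..}. f i ` \<Lambda>)"
  moreover have "(\<Union>i\<in>{1..}. f i ` \<Lambda>) \<subseteq> \<Lambda>" using perm by (auto simp: permutative_def)
  ultimately obtain x where x: "x \<in> \<Lambda>" "x \<notin> (\<Union>i\<in>{1..}. f i ` \<Lambda>)" by blast
  have s: "s i \<in> carrier A" "star A (s i) \<in> carrier A" if "i \<ge> 1" for i
    using A that by (auto simp: cuntz_relations_def star_closed)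
  have zero: "\<pi> (star A (s i)) (e x) = 0" if i: "i \<ge> 1" for i
  proof (rule orthogonal_basis_zero[OF onb])
    fix y assume y: "y \<in> \<Lambda>"
    have "cinner (\<pi> (star A (s i)) (e x)) (e y) = cinner (e x) (e (f i y))"
      using rep perm s i y by (auto simp: representation_def permutative_def)
    also have "\<dots> = 0"
      using perm x y i by (auto simp: permutative_def complete_orthonormal_basis_def)
    finally show "cinner (\<pi> (star A (s i)) (e x)) (e y) = 0" .
  qed
  have map0: "\<pi> b 0 = 0" if "b \<in> carrier A" for b
    using rep that by (auto simp: representation_def bounded_clinear_def linear_simps)
  have word: "\<pi> (alg_word A (map s [] @ [s m, star A (s (m + 1))] @
      map (\<lambda>j. star A (s j)) (rev []))) v = \<pi> (s m) (\<pi> (star A (s (m + 1))) v)"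
    if "m \<ge> 1" for m v
    using rep s[OF that] s[of "m + 1"] by (simp add: alg_word_def representation_def)
  have a_eq: "?a v = (\<Sum>\<^sub>\<infinity>m\<in>{1..}. sqrt (real m) *\<^sub>R \<pi> (s m) (\<pi> (star A (s (m + 1))) v))" for v
    unfolding boson_op_def using word by (auto intro!: infsum_cong)
  have a0: "?a 0 = 0" "?a (e x) = 0"
    unfolding a_eq by (auto simp: zero map0 s intro!: infsum_0)
  have orth: "cinner (e x) (?a w) = 0" for w
  proof -
    let ?g = "\<lambda>m. sqrt (real m) *\<^sub>R \<pi> (s m) (\<pi> (star A (s (m + 1))) w)"
    have g: "cinner (e x) (?g m) = 0" if "m \<ge> 1" for m
    proof -
      have "cinner (e x) (\<pi> (s m) v) = cinner (\<pi> (star A (s m)) (e x)) v" for v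
        using rep s that by (auto simp: representation_def)
      then show ?thesis using zero that by (simp add: scaleR_scaleC cinner_scaleC_right)
    qed
    show ?thesis
    proof (cases "?g summable_on {1..}")
      case True
      then have "((\<lambda>m. cinner (e x) (?g m)) has_sum cinner (e x) (infsum ?g {1..})) {1..}"
        by (intro has_sum_bounded_linear[OF bounded_linear_cinner_right] has_sum_infsum)
      then have "infsum (\<lambda>m. cinner (e x) (?g m)) {1..} = cinner (e x) (infsum ?g {1..})"
        by (rule infsumI)
      moreover have "infsum (\<lambda>m. cinner (e x) (?g m)) {1..} = 0"
        using g by (auto intro!: infsum_0)
      ultimately show ?thesis unfolding a_eq by simp
    qed (simp add: a_eq[simplified] infsum_not_exists)
  qed
  have adj: "adjoint_on ?D ?a y = 0" if "\<And>w. cinner (?a w) y = 0" for y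
    unfolding adjoint_on_def
  proof (rule the_equality)
    fix z assume z: "\<forall>w\<in>?D. cinner (?a w) y = cinner w z"
    show "z = 0"
    proof (rule orthogonal_basis_zero[OF onb])
      fix k assume "k \<in> \<Lambda>"
      then have "e k \<in> ?D" by (simp add: module.span_base[OF module_scaleC])
      then show "cinner z (e k) = 0"
        using z that cinner_commute[of z "e k"] by (metis complex_cnj_zero)
    qed
  qed (use that in simp)
  have "e x \<in> ?D" using x by (simp add: module.span_base[OF module_scaleC])
  moreover have "adjoint_on ?D ?a (e x) = 0" "adjoint_on ?D ?a 0 = 0"
    by (rule adj; metis orth cinner_commute complex_cnj_zero cinner_zero(2))+
  ultimately have "e x = 0" using ccr[of "e x"] a0 by simp
  moreover have "cinner (e x) (e x) = 1"
    using onb x(1) by (simp add: complete_orthonormal_basis_def)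
  ultimately show False by simp
qed

end

(* Write a_n for the n-th boson operator. Since each pi(s_j) has the bounded left inverse pi(s_j^* ),
   it commutes with all the series, so that a_(n+1) = rho(a_n) with rho(X) = sum_j s_j X s_j^*, and the
   adjoint is obtained in the same way from that of a_1. A basis vector is either of the form s_k w
   with w in the basis or killed by every s_j^*. Vectors of the second kind are killed by all the
   operators, and on those of the first kind everything follows from
     rho(X) s_k = s_k X,   a_1 s_k = sqrt(k-1) s_(k-1),   a_1^* s_k = sqrt(k) s_(k+1). *)
theory Submission
  imports Defs
begin

section \<open>Inner products, infinite series and adjoints\<close>

interpretation scaleC: Modules.module "scaleC :: complex \<Rightarrow> 'h \<Rightarrow> 'h::complex_inner"
  by (rule module_scaleC)

lemma cinner_sum_left: "cinner (\<Sum>i\<in>F. g i) w = (\<Sum>i\<in>F. cinner (g i) w)"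
  for w :: "'h::complex_inner"
  by (induction F rule: infinite_finite_induct) (auto simp: cinner_add_left)

lemma cinner_sum_right: "cinner w (\<Sum>i\<in>F. g i) = (\<Sum>i\<in>F. cinner w (g i))"
  for w :: "'h::complex_inner"
  by (induction F rule: infinite_finite_induct) (auto simp: cinner_add_right)

lemma infsum_finite_support:
  fixes g :: "'b \<Rightarrow> 'h::real_normed_vector"
  assumes "finite F" "F \<subseteq> K" "\<And>x. x \<in> K - F \<Longrightarrow> g x = 0"
  shows "infsum g K = sum g F"
proof -
  have "infsum g K = infsum g F"
    by (rule infsum_cong_neutral) (use assms in auto)
  with assms(1) show ?thesis by simp
qed

text \<open>No summability is assumed: convergence of the image series gives back convergence of the
  original one through \<open>T\<close>. So both series diverge together, and then both
  \<open>infsum\<close>s have the default value 0, which \<open>S\<close> preserves.\<close>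

lemma infsum_left_invertible:
  assumes S: "bounded_linear S" and T: "bounded_linear T" and TS: "\<And>v. T (S v) = v"
  shows "infsum (\<lambda>x. S (g x)) K = S (infsum g K)"
proof (cases "g summable_on K")
  case True
  then show ?thesis
    by (intro infsumI has_sum_bounded_linear[OF S] has_sum_infsum)
next
  case False
  have "\<not> (\<lambda>x. S (g x)) summable_on K"
  proof
    assume "(\<lambda>x. S (g x)) summable_on K"
    then have "(\<lambda>x. T (S (g x))) summable_on K"
      by (rule summable_on_bounded_linear[OF T])
    with False TS show False by simp
  qed
  with False show ?thesis
    using linear_0[OF bounded_linear.linear[OF S]] by (simp add: infsum_not_exists)
qed

lemma iterated_sum_left_invertible:
  assumes "bounded_linear S" "bounded_linear T" "\<And>v. T (S v) = v"
  shows "iterated_sum k (\<lambda>J. S (F J)) = S (iterated_sum k F)"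
  by (induction k arbitrary: F) (simp_all add: infsum_left_invertible[OF assms])

text \<open>All summation indices are positive, so agreement on lists of positive integers suffices.
  The restriction matters because nothing is known about \<open>s 0\<close>.\<close>

lemma iterated_sum_cong:
  assumes "\<And>J. set J \<subseteq> {1..} \<Longrightarrow> F J = G J"
  shows "iterated_sum k F = iterated_sum k G"
  using assms
proof (induction k arbitrary: F G)
  case 0
  then show ?case by simp
next
  case (Suc k)
  have "iterated_sum k (\<lambda>J. F (j # J)) = iterated_sum k (\<lambda>J. G (j # J))" if "j \<ge> 1" for j
    by (rule Suc.IH, rule Suc.prems) (use that in simp)
  then show ?case
    unfolding iterated_sum.simps by (intro infsum_cong) simp
qed

text \<open>The description in \<open>adjoint_on\<close> is unique because two representing vectors
  differ by a vector orthogonal to the whole basis.\<close>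

lemma adjoint_on_eqI:
  assumes onb: "complete_orthonormal_basis \<Lambda> e" and sub: "e ` \<Lambda> \<subseteq> D"
    and z: "\<And>x. x \<in> D \<Longrightarrow> cinner (T x) y = cinner x z"
  shows "adjoint_on D T y = z"
  unfolding adjoint_on_def
proof (rule the_equality)
  fix z' assume z': "\<forall>x\<in>D. cinner (T x) y = cinner x z'"
  have "z' - z = 0"
  proof (rule orthogonal_basis_zero[OF onb])
    fix x assume "x \<in> \<Lambda>"
    then have "cinner (e x) z' = cinner (e x) z" using sub z z' by force
    then have "cinner (e x) (z' - z) = 0" by (simp add: cinner_diff)
    then show "cinner (z' - z) (e x) = 0" by (metis cinner_commute complex_cnj_zero)
  qed
  then show "z' = z" by simp
qed (use z in simp)

section \<open>Linear endomorphisms of an algebraic span\<close>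

text \<open>Linearity is relative to \<open>D\<close>: the boson operators are total functions given
  by \<open>infsum\<close>, and their series are controlled only on the reference subspace.\<close>

definition lin_endo :: "'h::complex_inner set \<Rightarrow> ('h \<Rightarrow> 'h) \<Rightarrow> bool"
  where "lin_endo D X \<longleftrightarrow> (\<forall>v\<in>D. X v \<in> D) \<and> (\<forall>v\<in>D. \<forall>w\<in>D. X (v + w) = X v + X w) \<and>
    (\<forall>c. \<forall>v\<in>D. X (c *\<^sub>C v) = c *\<^sub>C X v)"

lemma lin_endo_in: "lin_endo D X \<Longrightarrow> v \<in> D \<Longrightarrow> X v \<in> D"
  by (simp add: lin_endo_def)

lemma lin_endo_scaleR: "lin_endo D X \<Longrightarrow> v \<in> D \<Longrightarrow> X (r *\<^sub>R v) = r *\<^sub>R X v"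
  by (simp add: lin_endo_def scaleR_scaleC)

lemma lin_endo_zero: "lin_endo D X \<Longrightarrow> v \<in> D \<Longrightarrow> X 0 = 0"
  using lin_endo_scaleR[of D X v 0] by simp

lemma lin_endo_comp: "lin_endo D X \<Longrightarrow> lin_endo D Y \<Longrightarrow> lin_endo D (\<lambda>v. X (Y v))"
  by (simp add: lin_endo_def)

lemma lin_endo_add:
  "lin_endo (cspan B) X \<Longrightarrow> lin_endo (cspan B) Y \<Longrightarrow> lin_endo (cspan B) (\<lambda>v. X v + Y v)"
  by (simp add: lin_endo_def scaleC.span_add scaleC_add_right algebra_simps)

lemma lin_endo_ident: "lin_endo D (\<lambda>v. v)"
  by (simp add: lin_endo_def)

lemma lin_endo_cmult: "lin_endo (cspan B) X \<Longrightarrow> lin_endo (cspan B) (\<lambda>v. r *\<^sub>R X v)"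
  by (simp add: lin_endo_def scaleR_scaleC scaleC.span_scale scaleC_add_right scaleC_scaleC
      mult.commute)

lemma bounded_clinear_linear: "bounded_clinear X \<Longrightarrow> X (v + w) = X v + X w"
  "bounded_clinear X \<Longrightarrow> X (c *\<^sub>C v) = c *\<^sub>C X v" "bounded_clinear X \<Longrightarrow> X 0 = 0"
  "bounded_clinear X \<Longrightarrow> X (r *\<^sub>R v) = r *\<^sub>R X v"
  by (auto simp: bounded_clinear_def linear_simps)

lemma lin_endo_bounded_clinear:
  assumes X: "bounded_clinear X" and B: "\<And>x. x \<in> B \<Longrightarrow> X x \<in> cspan B"
  shows "lin_endo (cspan B) X"
proof -
  have "X v \<in> cspan B" if "v \<in> cspan B" for v
    using that by (induction rule: scaleC.span_induct_alt)
      (auto simp: bounded_clinear_linear[OF X] intro: scaleC.span_add scaleC.span_scale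
        scaleC.span_zero B)
  then show ?thesis by (simp add: lin_endo_def bounded_clinear_linear[OF X])
qed

lemma lin_endo_eqI:
  assumes X: "lin_endo (cspan B) X" and Y: "lin_endo (cspan B) Y"
    and eq: "\<And>x. x \<in> B \<Longrightarrow> X x = Y x" and v: "v \<in> cspan B"
  shows "X v = Y v"
proof -
  \<comment> \<open>Membership is carried through the induction, since additivity of
    \<open>X\<close> and \<open>Y\<close> is available only on the span.\<close>
  have "v \<in> cspan B \<and> X v = Y v"
    using v
  proof (induction rule: scaleC.span_induct_alt)
    case base
    show ?case using lin_endo_zero[OF X] lin_endo_zero[OF Y] scaleC.span_zero by metis
  next
    case (step c x y)
    then have "x \<in> cspan B" "c *\<^sub>C x \<in> cspan B"
      by (auto intro: scaleC.span_base scaleC.span_scale)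
    with step X Y eq show ?case by (simp add: lin_endo_def scaleC.span_add)
  qed
  then show ?thesis ..
qed

text \<open>On each vector the series is a finite sum. Additivity follows by summing over the union
  of the supports for \<open>v\<close> and \<open>w\<close>, which also contains the support for
  \<open>v + w\<close>.\<close>

lemma lin_endo_series:
  assumes Q: "\<And>m. m \<ge> (1::nat) \<Longrightarrow> lin_endo (cspan B) (Q m)"
    and fin: "\<And>v. v \<in> cspan B \<Longrightarrow> finite {m\<in>{1..}. Q m v \<noteq> 0}"
  shows "lin_endo (cspan B) (\<lambda>v. \<Sum>\<^sub>\<infinity>m\<in>{1..}. Q m v)"
proof -
  let ?N = "\<lambda>v. {m\<in>{1..}. Q m v \<noteq> 0}"
  have eq: "(\<Sum>\<^sub>\<infinity>m\<in>{1..}. Q m v) = (\<Sum>m\<in>F. Q m v)"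
    if "?N v \<subseteq> F" "F \<subseteq> {1..}" "finite F" for v F
    using that by (intro infsum_finite_support) auto
  show ?thesis
    unfolding lin_endo_def
  proof (intro conjI ballI allI)
    fix v assume v: "v \<in> cspan B"
    have "(\<Sum>m\<in>?N v. Q m v) \<in> cspan B"
      using Q v by (intro scaleC.span_sum) (auto simp: lin_endo_def)
    then show "(\<Sum>\<^sub>\<infinity>m\<in>{1..}. Q m v) \<in> cspan B"
      using eq[OF order_refl _ fin[OF v]] by (metis (no_types, lifting) mem_Collect_eq subsetI)
    fix c
    have "?N (c *\<^sub>C v) \<subseteq> ?N v"
      using Q v by (auto simp: lin_endo_def)
    then show "(\<Sum>\<^sub>\<infinity>m\<in>{1..}. Q m (c *\<^sub>C v)) = c *\<^sub>C (\<Sum>\<^sub>\<infinity>m\<in>{1..}. Q m v)"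
      using eq[OF _ _ fin[OF v]] Q v
      by (subst (1 2) eq[OF _ _ fin[OF v]])
        (auto simp: scaleC.scale_sum_right lin_endo_def intro!: sum.cong)
  next
    fix v w assume v: "v \<in> cspan B" and w: "w \<in> cspan B"
    let ?F = "?N v \<union> ?N w"
    have "?N (v + w) \<subseteq> ?F" using Q v w by (auto simp: lin_endo_def)
    moreover have "finite ?F" using fin v w by blast
    ultimately show "(\<Sum>\<^sub>\<infinity>m\<in>{1..}. Q m (v + w)) = (\<Sum>\<^sub>\<infinity>m\<in>{1..}. Q m v) + (\<Sum>\<^sub>\<infinity>m\<in>{1..}. Q m w)"
      using Q v w
      by (subst (1 2 3) eq[of _ ?F])
        (auto simp: sum.distrib[symmetric] lin_endo_def intro!: sum.cong)
  qed
qed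

text \<open>With both supports finite, the series of termwise adjoints is the adjoint series, by
  finite additivity of the inner product.\<close>

lemma cinner_series:
  fixes v w :: "'h::complex_inner"
  assumes "finite {m\<in>{1::nat..}. Q m v \<noteq> 0}" "finite {m\<in>{1..}. R m w \<noteq> 0}"
    and adj: "\<And>m. m \<ge> 1 \<Longrightarrow> cinner (Q m v) w = cinner v (R m w)"
  shows "cinner (\<Sum>\<^sub>\<infinity>m\<in>{1..}. Q m v) w = cinner v (\<Sum>\<^sub>\<infinity>m\<in>{1..}. R m w)"
proof -
  let ?F = "{m\<in>{1..}. Q m v \<noteq> 0} \<union> {m\<in>{1..}. R m w \<noteq> 0}"
  have "finite ?F" using assms by blast
  then have "(\<Sum>\<^sub>\<infinity>m\<in>{1..}. Q m v) = (\<Sum>m\<in>?F. Q m v)" "(\<Sum>\<^sub>\<infinity>m\<in>{1..}. R m w) = (\<Sum>m\<in>?F. R m w)"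
    by (auto intro!: infsum_finite_support)
  then show ?thesis
    using adj by (auto simp: cinner_sum_left cinner_sum_right intro!: sum.cong)
qed

section \<open>Isometries with orthogonal ranges acting on a basis\<close>

text \<open>Extracts what the representation provides: \<open>S i\<close> stands for \<pi>(s_i),
  \<open>T i\<close> for its adjoint and \<open>B\<close> for the reference basis. The second
  alternative in \<open>B_cases\<close> allows for vacuum-like vectors outside all the
  ranges.\<close>

locale cuntz_family =
  fixes S T :: "nat \<Rightarrow> 'h::chilbert_space \<Rightarrow> 'h" and B :: "'h set"
  assumes S: "i \<ge> 1 \<Longrightarrow> bounded_clinear (S i)"
    and T: "i \<ge> 1 \<Longrightarrow> bounded_clinear (T i)"
    and T_S: "i \<ge> 1 \<Longrightarrow> j \<ge> 1 \<Longrightarrow> T i (S j v) = (if i = j then v else 0)"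
    and adj: "i \<ge> 1 \<Longrightarrow> cinner (S i v) w = cinner v (T i w)"
    and S_B: "i \<ge> 1 \<Longrightarrow> x \<in> B \<Longrightarrow> S i x \<in> B"
    and B_cases: "x \<in> B \<Longrightarrow> (\<exists>k\<ge>1. \<exists>y\<in>B. x = S k y) \<or> (\<forall>j\<ge>1. T j x = 0)"
begin

abbreviation "D \<equiv> cspan B"

lemma adj': "i \<ge> 1 \<Longrightarrow> cinner (T i v) w = cinner v (S i w)"
  by (metis adj cinner_commute)

lemma S_endo: "i \<ge> 1 \<Longrightarrow> lin_endo D (S i)"
  by (rule lin_endo_bounded_clinear) (auto simp: S S_B scaleC.span_base)

lemma T_endo:
  assumes i: "i \<ge> 1"
  shows "lin_endo D (T i)"
proof (rule lin_endo_bounded_clinear[OF T[OF i]])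
  fix x assume "x \<in> B"
  with B_cases[of x] i T_S show "T i x \<in> D"
    by (auto intro: scaleC.span_base scaleC.span_zero)
qed

text \<open>At most one \<open>T j\<close> is nonzero on a given basis vector, so only finitely many
  are nonzero on a linear combination. This is why all the series are finite sums on
  \<open>D\<close>.\<close>

lemma finite_T: "v \<in> D \<Longrightarrow> finite {j\<in>{1..}. T j v \<noteq> 0}"
proof (induction rule: scaleC.span_induct_alt)
  case base
  then show ?case by (auto simp: bounded_clinear_linear[OF T] cong: conj_cong)
next
  case (step c x y)
  have "finite {j\<in>{1..}. T j x \<noteq> 0}"
    using B_cases[OF step(1)]
  proof
    assume "\<exists>k\<ge>1. \<exists>y\<in>B. x = S k y"
    then obtain k y where "k \<ge> 1" "x = S k y" by blast
    then have "{j\<in>{1..}. T j x \<noteq> 0} \<subseteq> {k}" using T_S by (auto split: if_splits)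
    then show ?thesis by (rule finite_subset) simp
  next
    assume "\<forall>j\<ge>1. T j x = 0"
    then have "{j\<in>{1..}. T j x \<noteq> 0} = {}" by auto
    then show ?thesis by (simp only: finite.emptyI)
  qed
  moreover have "{j\<in>{1..}. T j (c *\<^sub>C x + y) \<noteq> 0} \<subseteq>
      {j\<in>{1..}. T j x \<noteq> 0} \<union> {j\<in>{1..}. T j y \<noteq> 0}"
    by (auto simp: bounded_clinear_linear[OF T])
  ultimately show ?case using step(2) by (meson finite_Un finite_subset)
qed

section \<open>The recursion, the lowering and raising operators, and their adjoints\<close>

definition recur :: "('h \<Rightarrow> 'h) \<Rightarrow> 'h \<Rightarrow> 'h"
  where "recur X v = (\<Sum>\<^sub>\<infinity>j\<in>{1..}. S j (X (T j v)))"

definition low :: "'h \<Rightarrow> 'h"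
  where "low v = (\<Sum>\<^sub>\<infinity>m\<in>{1..}. sqrt (real m) *\<^sub>R S m (T (m + 1) v))"

text \<open>The candidate for the adjoint of \<open>low\<close>, obtained by taking the adjoint of
  each term.\<close>

definition rais :: "'h \<Rightarrow> 'h"
  where "rais v = (\<Sum>\<^sub>\<infinity>m\<in>{1..}. sqrt (real m) *\<^sub>R S (m + 1) (T m v))"

lemma finite_recur:
  assumes "lin_endo D X" "v \<in> D"
  shows "finite {j\<in>{1..}. S j (X (T j v)) \<noteq> 0}"
  by (rule finite_subset[OF _ finite_T[OF assms(2)]])
    (use lin_endo_zero[OF assms] in \<open>auto simp: bounded_clinear_linear[OF S]\<close>)

lemma finite_low:
  assumes "v \<in> D"
  shows "finite {m\<in>{1..}. sqrt (real m) *\<^sub>R S m (T (m + 1) v) \<noteq> 0}"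
proof (rule finite_subset)
  \<comment> \<open>The term with index m contains \<open>T (m + 1)\<close>, so its support lies in
    the preimage under \<open>Suc\<close> of the finite set from \<open>finite_T\<close>.\<close>
  show "{m\<in>{1..}. sqrt (real m) *\<^sub>R S m (T (m + 1) v) \<noteq> 0} \<subseteq>
      Suc -` {j\<in>{1..}. T j v \<noteq> 0}"
    by (auto simp: bounded_clinear_linear[OF S])
  show "finite (Suc -` {j\<in>{1..}. T j v \<noteq> 0})"
    by (rule finite_vimageI[OF finite_T[OF assms]]) simp
qed

lemma finite_rais:
  assumes "v \<in> D"
  shows "finite {m\<in>{1..}. sqrt (real m) *\<^sub>R S (m + 1) (T m v) \<noteq> 0}"
  by (rule finite_subset[OF _ finite_T[OF assms]]) (auto simp: bounded_clinear_linear[OF S])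

lemma recur_endo: "lin_endo D X \<Longrightarrow> lin_endo D (recur X)"
  unfolding recur_def[abs_def]
  by (intro lin_endo_series finite_recur lin_endo_comp[OF S_endo] lin_endo_comp[OF _ T_endo]) auto

lemma low_endo: "lin_endo D low"
  unfolding low_def[abs_def]
  by (intro lin_endo_series finite_low lin_endo_cmult lin_endo_comp[OF S_endo] T_endo) auto

lemma rais_endo: "lin_endo D rais"
  unfolding rais_def[abs_def]
  by (intro lin_endo_series finite_rais lin_endo_cmult lin_endo_comp[OF S_endo] T_endo) auto

lemma funpow_recur_endo: "lin_endo D X \<Longrightarrow> lin_endo D ((recur ^^ n) X)"
  by (induction n) (auto intro: recur_endo)

lemma low_rais_adjoint: "v \<in> D \<Longrightarrow> w \<in> D \<Longrightarrow> cinner (low v) w = cinner v (rais w)"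
  unfolding low_def rais_def
  by (rule cinner_series[OF finite_low finite_rais])
    (auto simp: scaleR_scaleC cinner_scaleC_left cinner_scaleC_right adj adj')

text \<open>Moving \<open>S j\<close>, \<open>X\<close> and \<open>T j\<close> across the inner
  product one after another turns S_j X T_j into S_j Y T_j.\<close>

lemma recur_adjoint:
  assumes "lin_endo D X" "lin_endo D Y"
    and XY: "\<And>v w. v \<in> D \<Longrightarrow> w \<in> D \<Longrightarrow> cinner (X v) w = cinner v (Y w)"
    and "v \<in> D" "w \<in> D"
  shows "cinner (recur X v) w = cinner v (recur Y w)"
  unfolding recur_def
  by (rule cinner_series[OF finite_recur finite_recur])
    (use assms in \<open>auto simp: adj adj'[symmetric] XY lin_endo_in[OF T_endo]\<close>)

lemma funpow_recur_adjoint: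
  assumes "v \<in> D" "w \<in> D"
  shows "cinner ((recur ^^ n) low v) w = cinner v ((recur ^^ n) rais w)"
  using assms
proof (induction n arbitrary: v w)
  case 0
  then show ?case by (simp add: low_rais_adjoint)
next
  case (Suc n)
  then show ?case
    by (simp add: recur_adjoint[OF funpow_recur_endo[OF low_endo] funpow_recur_endo[OF rais_endo]])
qed

section \<open>Action on the ranges of the isometries\<close>

lemma recur_S:
  assumes "k \<ge> 1" "X 0 = 0"
  shows "recur X (S k v) = S k (X v)"
proof -
  have "recur X (S k v) = (\<Sum>j\<in>{k}. S j (X (T j (S k v))))"
    unfolding recur_def
    by (rule infsum_finite_support) (use assms in \<open>auto simp: T_S bounded_clinear_linear[OF S]\<close>)
  with assms show ?thesis by (simp add: T_S)
qed

lemma low_S: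
  assumes "k \<ge> 1"
  shows "low (S k v) = sqrt (real (k - 1)) *\<^sub>R S (max 1 (k - 1)) v"
proof -
  \<comment> \<open>Only m = k - 1 can contribute. Removing 0 leaves the empty sum for k = 1, in
    agreement with the weight 0 on the right-hand side.\<close>
  have "low (S k v) = (\<Sum>m\<in>{k - 1} - {0}. sqrt (real m) *\<^sub>R S m (T (m + 1) (S k v)))"
    unfolding low_def
    by (rule infsum_finite_support) (use assms in \<open>auto simp: T_S bounded_clinear_linear[OF S]\<close>)
  also have "\<dots> = sqrt (real (k - 1)) *\<^sub>R S (max 1 (k - 1)) v"
    using assms by (cases "k = 1") (auto simp: T_S max_def insert_Diff_if)
  finally show ?thesis .
qed

lemma rais_S:
  assumes "k \<ge> 1"
  shows "rais (S k v) = sqrt (real k) *\<^sub>R S (k + 1) v"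
proof -
  have "rais (S k v) = (\<Sum>m\<in>{k}. sqrt (real m) *\<^sub>R S (m + 1) (T m (S k v)))"
    unfolding rais_def
    by (rule infsum_finite_support) (use assms in \<open>auto simp: T_S bounded_clinear_linear[OF S]\<close>)
  with assms show ?thesis by (simp add: T_S)
qed

lemma killed:
  assumes "\<And>j. j \<ge> 1 \<Longrightarrow> T j v = 0"
  shows "X 0 = 0 \<Longrightarrow> recur X v = 0" "low v = 0" "rais v = 0"
  using assms
  by (auto simp: recur_def low_def rais_def bounded_clinear_linear[OF S] intro!: infsum_0)

text \<open>The common form of \<open>low\<close> and \<open>rais\<close>. For \<open>low\<close>, \<open>k = 1\<close> has weight \<open>0\<close>, and \<open>p 1 = 1\<close>
  only serves to avoid the meaningless \<open>S 0\<close>.\<close>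

definition weighted_shift :: "('h \<Rightarrow> 'h) \<Rightarrow> bool"
  where "weighted_shift P \<longleftrightarrow> lin_endo D P \<and>
    (\<forall>v. (\<forall>j\<ge>1. T j v = 0) \<longrightarrow> P v = 0) \<and>
    (\<exists>c p. \<forall>k\<ge>1. p k \<ge> (1::nat) \<and> (\<forall>v. P (S k v) = (c k :: real) *\<^sub>R S (p k) v))"

lemma weighted_shift_low: "weighted_shift low"
proof -
  have "\<forall>k\<ge>1. max 1 (k - 1) \<ge> 1 \<and>
      (\<forall>v. low (S k v) = sqrt (real (k - 1)) *\<^sub>R S (max 1 (k - 1)) v)"
    by (simp add: low_S)
  then show ?thesis
    unfolding weighted_shift_def using low_endo killed(2)
    by (intro conjI exI[of _ "\<lambda>k. sqrt (real (k - 1))"] exI[of _ "\<lambda>k. max 1 (k - 1)"]) auto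
qed

lemma weighted_shift_rais: "weighted_shift rais"
  unfolding weighted_shift_def using rais_endo killed(3) rais_S
  by (intro conjI exI[of _ "\<lambda>k. sqrt (real k)"] exI[of _ "\<lambda>k. k + 1"]) auto

section \<open>Commutation relations\<close>

text \<open>Reduces an identity on \<open>D\<close> to the two kinds of basis vectors in
  \<open>B_cases\<close>: those in the range of some \<open>S k\<close> and those killed by every
  \<open>T j\<close>.\<close>

lemma D_eqI:
  assumes "lin_endo D X" "lin_endo D Y" "v \<in> D"
    and "\<And>k y. k \<ge> 1 \<Longrightarrow> y \<in> D \<Longrightarrow> X (S k y) = Y (S k y)"
    and "\<And>x. x \<in> B \<Longrightarrow> (\<And>j. j \<ge> 1 \<Longrightarrow> T j x = 0) \<Longrightarrow> X x = Y x"
  shows "X v = Y v"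
proof (rule lin_endo_eqI[OF assms(1,2) _ assms(3)])
  fix x assume "x \<in> B"
  with B_cases[of x] assms(4,5) show "X x = Y x" by (metis scaleC.span_base)
qed

text \<open>\<open>P\<close> changes only the index of \<open>S k y\<close>, whereas
  \<open>recur X\<close> changes only \<open>y\<close>. Both orders therefore give c_k S_(p k) (X
  y).\<close>

lemma weighted_shift_recur_commute:
  assumes P: "weighted_shift P" and X: "lin_endo D X" and v: "v \<in> D"
  shows "P (recur X v) = recur X (P v)"
proof -
  have P_endo: "lin_endo D P" using P by (simp add: weighted_shift_def)
  have P_killed: "P u = 0" if "\<forall>j\<ge>1. T j u = 0" for u
    using P that by (simp add: weighted_shift_def)
  obtain c p where c: "\<And>k u. k \<ge> 1 \<Longrightarrow> P (S k u) = (c k :: real) *\<^sub>R S (p k) u"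
    and p: "\<And>k. k \<ge> 1 \<Longrightarrow> p k \<ge> (1::nat)"
    using P unfolding weighted_shift_def by blast
  note rX = recur_endo[OF X]
  have zero: "X 0 = 0" "P 0 = 0" "recur X 0 = 0"
    using lin_endo_zero[OF X v] lin_endo_zero[OF P_endo v] lin_endo_zero[OF rX v] .
  show ?thesis
  proof (rule D_eqI[OF lin_endo_comp[OF P_endo rX] lin_endo_comp[OF rX P_endo] v])
    fix k y assume k: "k \<ge> (1::nat)" and y: "y \<in> D"
    then show "P (recur X (S k y)) = recur X (P (S k y))"
      using zero p c
      by (simp add: recur_S lin_endo_scaleR[OF rX] lin_endo_in[OF S_endo])
  next
    fix x assume "\<And>j. j \<ge> 1 \<Longrightarrow> T j x = 0"
    then show "P (recur X x) = recur X (P x)"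
      using P_killed zero by (simp add: killed(1))
  qed
qed

text \<open>On \<open>S k y\<close> the recursion is multiplicative: the two sides are
  \<open>S k (X (Y y))\<close> and \<open>S k (Y (X y))\<close>.\<close>

lemma recur_commute:
  assumes X: "lin_endo D X" and Y: "lin_endo D Y"
    and XY: "\<And>v. v \<in> D \<Longrightarrow> X (Y v) = Y (X v)" and v: "v \<in> D"
  shows "recur X (recur Y v) = recur Y (recur X v)"
proof -
  note r = recur_endo[OF X] recur_endo[OF Y]
  note zero = lin_endo_zero[OF X v] lin_endo_zero[OF Y v] lin_endo_zero[OF r(1) v] lin_endo_zero[OF r(2) v]
  show ?thesis
    by (rule D_eqI[OF lin_endo_comp[OF r(1,2)] lin_endo_comp[OF r(2,1)] v])
      (use zero XY in \<open>simp_all add: recur_S killed(1)\<close>)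
qed

text \<open>One \<open>recur\<close> is stripped from both sides by \<open>recur_commute\<close>
  until one exponent is 0. As the exponents differ, the other is still positive, and a weighted
  shift commutes with everything of the form \<open>recur X\<close>.\<close>

lemma funpow_recur_commute:
  assumes P: "weighted_shift P" and Q: "weighted_shift Q" and "n \<noteq> m" and "v \<in> D"
  shows "(recur ^^ n) P ((recur ^^ m) Q v) = (recur ^^ m) Q ((recur ^^ n) P v)"
  using assms(3,4)
proof (induction n arbitrary: m v)
  have endo: "lin_endo D P" "lin_endo D Q" using P Q by (auto simp: weighted_shift_def)
  note pow = endo[THEN funpow_recur_endo]
  case 0
  then obtain m' where "m = Suc m'" by (cases m) auto
  with 0 show ?case by (simp add: weighted_shift_recur_commute[OF P pow(2)])
next
  have endo: "lin_endo D P" "lin_endo D Q" using P Q by (auto simp: weighted_shift_def)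
  note pow = endo[THEN funpow_recur_endo]
  case (Suc n)
  show ?case
  proof (cases m)
    case 0
    with Suc.prems show ?thesis by (simp add: weighted_shift_recur_commute[OF Q pow(1)])
  next
    case (Suc m')
    with Suc.prems show ?thesis
      by simp (rule recur_commute[OF pow], auto intro: Suc.IH)
  qed
qed

text \<open>For exponent 0 the commutator on \<open>S k y\<close> is k - (k - 1) = 1. The recursion
  then carries the relation to higher exponents, because under the covering hypothesis it sends the
  identity to the identity.\<close>

lemma funpow_recur_low_rais:
  assumes cover: "\<And>x. x \<in> B \<Longrightarrow> \<exists>k\<ge>1. \<exists>y\<in>B. x = S k y" and v: "v \<in> D"
  shows "(recur ^^ n) low ((recur ^^ n) rais v) = (recur ^^ n) rais ((recur ^^ n) low v) + v"
proof -
  note pow = low_endo[THEN funpow_recur_endo] rais_endo[THEN funpow_recur_endo]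
  \<comment> \<open>By the covering hypothesis every basis vector lies in a range, so the second
    case of \<open>D_eqI\<close> does not arise.\<close>
  have ext: "X v = Y v"
    if "lin_endo D X" "lin_endo D Y" "v \<in> D"
      "\<And>k y. k \<ge> 1 \<Longrightarrow> y \<in> D \<Longrightarrow> X (S k y) = Y (S k y)" for X Y v
    using that cover by (intro lin_endo_eqI[of B X Y v]) (metis scaleC.span_base)+
  show ?thesis
    using v
  proof (induction n arbitrary: v)
    case 0
    have "low (rais v) = rais (low v) + v"
    proof (rule ext[OF lin_endo_comp[OF low_endo rais_endo]
            lin_endo_add[OF lin_endo_comp[OF rais_endo low_endo] lin_endo_ident] 0])
      fix k y assume k: "k \<ge> (1::nat)" and y: "y \<in> D"
      have "low (rais (S k y)) = real k *\<^sub>R S k y"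
        using k y by (simp add: rais_S low_S lin_endo_scaleR[OF low_endo] lin_endo_in[OF S_endo])
      also have "real k = real (k - 1) + 1" using k by simp
      also have "\<dots> *\<^sub>R S k y = rais (low (S k y)) + S k y"
      \<comment> \<open>For k = 1 the lowering operator has weight 0 and only the identity term
        remains.\<close>
      proof (cases "k = 1")
        case True
        then show ?thesis by (simp add: low_S lin_endo_zero[OF rais_endo y])
      next
        case False
        with k obtain l where "k = Suc l" "l \<ge> 1" by (cases k) auto
        with y show ?thesis
          by (simp add: rais_S low_S lin_endo_scaleR[OF rais_endo] lin_endo_in[OF S_endo]
              algebra_simps)
      qed
      finally show "low (rais (S k y)) = rais (low (S k y)) + S k y" .
    qed
    then show ?case by simp
  next
    case (Suc n)
    let ?X = "(recur ^^ n) low" and ?Y = "(recur ^^ n) rais"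
    note r = pow[of "Suc n", simplified]
    note zero = lin_endo_zero[OF pow(1) Suc.prems] lin_endo_zero[OF pow(2) Suc.prems]
    have "recur ?X (recur ?Y v) = recur ?Y (recur ?X v) + v"
    proof (rule ext[OF lin_endo_comp[OF r] lin_endo_add[OF lin_endo_comp[OF r(2,1)] lin_endo_ident]
          Suc.prems])
      fix k y assume "k \<ge> (1::nat)" "y \<in> D"
      then show "recur ?X (recur ?Y (S k y)) = recur ?Y (recur ?X (S k y)) + S k y"
        by (simp add: recur_S zero Suc.IH bounded_clinear_linear[OF S])
    qed
    then show ?case by simp
  qed
qed

section \<open>From the iterated series to powers of the recursion\<close>

text \<open>The outermost index j is the head of the list: its \<open>S j\<close> comes last and is
  pulled out of all inner series, while its \<open>T j\<close> is applied first to \<open>v\<close>.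
  Since \<open>S j\<close> has a bounded left inverse, this holds for every \<open>v\<close>,
  whether or not the series converge.\<close>

lemma iterated_sum_eq_recur:
  "iterated_sum k (\<lambda>J. \<Sum>\<^sub>\<infinity>m\<in>{1..}. sqrt (real m) *\<^sub>R
      foldr S J (S m (T (m + 1) (fold T J v)))) = (recur ^^ k) low v"
proof (induction k arbitrary: v)
  case 0
  then show ?case by (simp add: low_def)
next
  case (Suc k)
  let ?W = "\<lambda>J v. \<Sum>\<^sub>\<infinity>m\<in>{1..}. sqrt (real m) *\<^sub>R foldr S J (S m (T (m + 1) (fold T J v)))"
  have "iterated_sum k (\<lambda>J. ?W (j # J) v) = S j ((recur ^^ k) low (T j v))" if j: "j \<ge> 1" for j
  proof -
    have inv: "bounded_linear (S j)" "bounded_linear (T j)" "\<And>u. T j (S j u) = u"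
      using S[OF j] T[OF j] T_S j by (auto simp: bounded_clinear_def)
    have "?W (j # J) v = S j (?W J (T j v))" for J
      using bounded_clinear_linear(4)[OF S[OF j], symmetric]
      by (simp add: infsum_left_invertible[OF inv])
    then show ?thesis
      by (simp only: iterated_sum_left_invertible[OF inv] Suc.IH)
  qed
  then show ?case by (auto simp: recur_def[of "(recur ^^ k) low"] intro!: infsum_cong)
qed

end

section \<open>Permutative representations give such families\<close>

lemma representation_zero:
  assumes "ring A" and rep: "representation A \<pi>"
  shows "\<pi> \<zero>\<^bsub>A\<^esub> v = 0"
proof -
  interpret ring A by fact
  have "\<pi> (\<zero>\<^bsub>A\<^esub> \<oplus>\<^bsub>A\<^esub> \<zero>\<^bsub>A\<^esub>) v = \<pi> \<zero>\<^bsub>A\<^esub> v + \<pi> \<zero>\<^bsub>A\<^esub> v"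
    using rep zero_closed unfolding representation_def by blast
  then show ?thesis by simp
qed

text \<open>Representations are not assumed unital. The image of the unit is a projection, equal to
  \<pi>(s_1)^* \<pi>(s_1), and \<pi>(s_1) maps basis vectors to unit vectors. So the projection
  fixes the basis, and hence everything.\<close>

lemma permutative_one:
  assumes A: "unital_cstar_algebra A" "cuntz_relations A s" and rep: "representation A \<pi>"
    and perm: "permutative s \<pi> \<Lambda> e f"
  shows "\<pi> \<one>\<^bsub>A\<^esub> v = v"
proof -
  interpret unital_cstar_algebra A by fact
  have onb: "complete_orthonormal_basis \<Lambda> e" using perm by (simp add: permutative_def)
  have s: "s 1 \<in> carrier A" "star A (s 1) \<in> carrier A"
    "star A (s 1) \<otimes>\<^bsub>A\<^esub> s 1 = \<one>\<^bsub>A\<^esub>"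
    using A by (auto simp: cuntz_relations_def star_closed)
  have \<pi>1: "\<pi> \<one>\<^bsub>A\<^esub> u = \<pi> (star A (s 1)) (\<pi> (s 1) u)" for u
    using rep s(1,2) unfolding s(3)[symmetric] by (simp add: representation_def)
  have adj: "cinner (\<pi> (star A (s 1)) u) w = cinner u (\<pi> (s 1) w)" for u w
    using rep s by (simp add: representation_def)
  have isom: "cinner (\<pi> \<one>\<^bsub>A\<^esub> u) w = cinner (\<pi> (s 1) u) (\<pi> (s 1) w)" for u w
    unfolding \<pi>1 by (rule adj)
  have sa: "cinner (\<pi> \<one>\<^bsub>A\<^esub> u) w = cinner u (\<pi> \<one>\<^bsub>A\<^esub> w)" for u w
    by (metis isom cinner_commute)
  have idem: "\<pi> \<one>\<^bsub>A\<^esub> (\<pi> \<one>\<^bsub>A\<^esub> u) = \<pi> \<one>\<^bsub>A\<^esub> u" for u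
  proof -
    have "monoid A" by unfold_locales
    then have "\<one>\<^bsub>A\<^esub> \<in> carrier A" "\<one>\<^bsub>A\<^esub> \<otimes>\<^bsub>A\<^esub> \<one>\<^bsub>A\<^esub> = \<one>\<^bsub>A\<^esub>"
      by (simp_all add: monoid.one_closed monoid.r_one)
    moreover from this have "\<pi> (\<one>\<^bsub>A\<^esub> \<otimes>\<^bsub>A\<^esub> \<one>\<^bsub>A\<^esub>) u = \<pi> \<one>\<^bsub>A\<^esub> (\<pi> \<one>\<^bsub>A\<^esub> u)"
      using rep unfolding representation_def by blast
    ultimately show ?thesis by simp
  qed
  have fix_e: "\<pi> \<one>\<^bsub>A\<^esub> (e x) = e x" if x: "x \<in> \<Lambda>" for x
  proof -
    have "cinner (\<pi> \<one>\<^bsub>A\<^esub> (e x)) (e x) = 1" "cinner (e x) (e x) = 1"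
      using perm x unfolding isom by (auto simp: permutative_def complete_orthonormal_basis_def)
    \<comment> \<open>Expanding with self-adjointness and idempotence makes every one of the four
      inner products equal to 1, giving 1 - 1 - 1 + 1.\<close>
    then have "cinner (\<pi> \<one>\<^bsub>A\<^esub> (e x) - e x) (\<pi> \<one>\<^bsub>A\<^esub> (e x) - e x) = 0"
      by (simp add: cinner_diff sa idem)
    then show ?thesis by (simp add: cinner_eq_zero_self)
  qed
  have "\<pi> \<one>\<^bsub>A\<^esub> v - v = 0"
    by (rule orthogonal_basis_zero[OF onb]) (simp add: cinner_diff sa fix_e)
  then show ?thesis by simp
qed

text \<open>\<open>alg_word\<close> ends with the unit of the algebra, which is why the unit has to
  act as the identity.\<close>

lemma representation_alg_word:
  assumes "ring A" and rep: "representation A \<pi>" and one: "\<And>v. \<pi> \<one>\<^bsub>A\<^esub> v = v"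
    and xs: "set xs \<subseteq> carrier A"
  shows "\<pi> (alg_word A xs) v = foldr \<pi> xs v"
proof -
  interpret ring A by fact
  have "alg_word A xs \<in> carrier A \<and> \<pi> (alg_word A xs) v = foldr \<pi> xs v"
    using xs
  proof (induction xs)
    case (Cons x xs)
    then have "\<pi> (x \<otimes>\<^bsub>A\<^esub> alg_word A xs) v = \<pi> x (\<pi> (alg_word A xs) v)"
      using rep by (auto simp: representation_def)
    with Cons show ?case by (auto simp: alg_word_def)
  qed (simp add: alg_word_def one)
  then show ?thesis ..
qed

lemma cuntz_family_permutative:
  assumes A: "unital_cstar_algebra A" "cuntz_relations A s" and rep: "representation A \<pi>"
    and perm: "permutative s \<pi> \<Lambda> e f"
  shows "cuntz_family (\<lambda>i. \<pi> (s i)) (\<lambda>i. \<pi> (star A (s i))) (e ` \<Lambda>)"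
proof -
  interpret unital_cstar_algebra A by fact
  have is_ring: "ring A" by unfold_locales
  have onb: "complete_orthonormal_basis \<Lambda> e" using perm by (simp add: permutative_def)
  have s: "s i \<in> carrier A" "star A (s i) \<in> carrier A" if "i \<ge> 1" for i
    using A that by (auto simp: cuntz_relations_def star_closed)
  have adj: "cinner (\<pi> (star A (s i)) v) w = cinner v (\<pi> (s i) w)" if "i \<ge> 1" for i v w
    using rep s that by (simp add: representation_def)
  have se: "f i x \<in> \<Lambda>" "\<pi> (s i) (e x) = e (f i x)" if "i \<ge> 1" "x \<in> \<Lambda>" for i x
    using perm that by (auto simp: permutative_def)
  show ?thesis
  proof
    fix i j :: nat and v assume ij: "i \<ge> 1" "j \<ge> 1"
    have "\<pi> (star A (s i)) (\<pi> (s j) v) = \<pi> (star A (s i) \<otimes>\<^bsub>A\<^esub> s j) v"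
      using rep s ij by (simp add: representation_def)
    also have "star A (s i) \<otimes>\<^bsub>A\<^esub> s j = (if i = j then \<one>\<^bsub>A\<^esub> else \<zero>\<^bsub>A\<^esub>)"
      using A ij by (simp add: cuntz_relations_def)
    finally show "\<pi> (star A (s i)) (\<pi> (s j) v) = (if i = j then v else 0)"
      using permutative_one[OF A rep perm] representation_zero[OF is_ring rep] by simp
  next
    fix x assume "x \<in> e ` \<Lambda>"
    then obtain z where z: "x = e z" "z \<in> \<Lambda>" by blast
    show "(\<exists>k\<ge>1. \<exists>y\<in>e ` \<Lambda>. x = \<pi> (s k) y) \<or> (\<forall>j\<ge>1. \<pi> (star A (s j)) x = 0)"
    proof (rule disjCI)
      assume *: "\<not> (\<forall>j\<ge>1. \<pi> (star A (s j)) x = 0)"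
      then obtain j where j: "j \<ge> 1" "\<pi> (star A (s j)) x \<noteq> 0" by blast
      \<comment> \<open>A nonzero vector pairs nontrivially with some basis vector. Moving
        \<pi>(s_j) across, e_z is not orthogonal to e_(f_j(y)), so orthonormality forces z =
        f_j(y).\<close>
      then obtain y where y: "y \<in> \<Lambda>" "cinner (\<pi> (star A (s j)) x) (e y) \<noteq> 0"
        using orthogonal_basis_zero[OF onb] by blast
      then have "cinner (e z) (e (f j y)) \<noteq> 0" using j z by (simp add: adj se)
      with onb z se[OF j(1) y(1)] have "z = f j y"
        by (auto simp: complete_orthonormal_basis_def split: if_splits)
      with j y z have "e y \<in> e ` \<Lambda>" "x = \<pi> (s j) (e y)" by (simp_all add: se)
      with j(1) show "\<exists>k\<ge>1. \<exists>y\<in>e ` \<Lambda>. x = \<pi> (s k) y" by blast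
    qed
  next
    fix i :: nat and v w assume "i \<ge> 1"
    then show "cinner (\<pi> (s i) v) w = cinner v (\<pi> (star A (s i)) w)"
      by (metis adj cinner_commute)
  qed (use rep s se in \<open>auto simp: representation_def\<close>)
qed

lemma boson_op_eq_recur:
  assumes A: "unital_cstar_algebra A" "cuntz_relations A s" and rep: "representation A \<pi>"
    and perm: "permutative s \<pi> \<Lambda> e f"
  defines "S \<equiv> \<lambda>i. \<pi> (s i)" and "T \<equiv> \<lambda>i. \<pi> (star A (s i))"
  shows "boson_op A s \<pi> n v =
    (cuntz_family.recur S T ^^ (n - 1)) (cuntz_family.low S T) v"
proof -
  interpret unital_cstar_algebra A by fact
  have is_ring: "ring A" by unfold_locales
  interpret F: cuntz_family S T "e ` \<Lambda>"
    unfolding S_def T_def by (rule cuntz_family_permutative[OF A rep perm])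
  have s: "s i \<in> carrier A" "star A (s i) \<in> carrier A" if "i \<ge> 1" for i
    using A that by (auto simp: cuntz_relations_def star_closed)
  \<comment> \<open>The adjoints occur in the order \<open>rev J\<close>, so the head of
    \<open>J\<close> acts first on \<open>v\<close>; hence \<open>fold\<close> for \<open>T\<close>
    but \<open>foldr\<close> for \<open>S\<close>.\<close>
  have word: "\<pi> (alg_word A (map s J @ [s m, star A (s (m + 1))] @
      map (\<lambda>j. star A (s j)) (rev J))) v = foldr S J (S m (T (m + 1) (fold T J v)))"
    if "set J \<subseteq> {1..}" "m \<ge> 1" for J m
  proof -
    have "set (map s J @ [s m, star A (s (m + 1))] @ map (\<lambda>j. star A (s j)) (rev J)) \<subseteq> carrier A"
      using that s by auto
    from representation_alg_word[OF is_ring rep permutative_one[OF A rep perm] this]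
    show ?thesis
      by (simp add: foldr_map foldr_conv_fold fold_map o_def S_def T_def rev_map)
  qed
  show ?thesis
    unfolding boson_op_def F.iterated_sum_eq_recur[symmetric]
    by (intro iterated_sum_cong infsum_cong) (use word in auto)
qed

(* The covering guard in the case n = m cannot be dropped: see boson_relation_imp_cover. *)
theorem fact1p2:
  fixes A :: "'a cstar" and s :: "nat \<Rightarrow> 'a"
    and \<pi> :: "'a \<Rightarrow> 'h::chilbert_space \<Rightarrow> 'h"
    and \<Lambda> :: "'i set" and e :: "'i \<Rightarrow> 'h" and f :: "nat \<Rightarrow> 'i \<Rightarrow> 'i"
    and D :: "'h set" and a a' :: "nat \<Rightarrow> 'h \<Rightarrow> 'h"
  assumes "is_cuntz_algebra_infty A s"
    and "representation A \<pi>"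
    and "permutative s \<pi> \<Lambda> e f"
    and "D = cspan (e ` \<Lambda>)"
    and "\<And>n. a n = boson_op A s \<pi> n"
    and "\<And>n. a' n = adjoint_on D (a n)"
  shows
    "(\<forall>n\<ge>1. \<forall>v\<in>D. a n v \<in> D \<and> (\<exists>z\<in>D. \<forall>w\<in>D. cinner (a n w) v = cinner w z)) \<and>
     (\<forall>n\<ge>1. \<forall>m\<ge>1. \<forall>v\<in>D. (n = m \<longrightarrow> \<Lambda> = (\<Union>i\<in>{1..}. f i ` \<Lambda>)) \<longrightarrow>
        a n (a' m v) - a' m (a n v) = (if n = m then v else 0)) \<and>
     (\<forall>n\<ge>1. \<forall>m\<ge>1. \<forall>v\<in>D.
        a n (a m v) - a m (a n v) = 0 \<and> a' n (a' m v) - a' m (a' n v) = 0)"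
proof -
  have A: "unital_cstar_algebra A" "cuntz_relations A s"
    using assms(1) by (auto simp: is_cuntz_algebra_infty_def)
  note rep = assms(2) and perm = assms(3)
  have onb: "complete_orthonormal_basis \<Lambda> e" using perm by (simp add: permutative_def)
  define S T where "S = (\<lambda>i. \<pi> (s i))" and "T = (\<lambda>i. \<pi> (star A (s i)))"
  interpret F: cuntz_family S T "e ` \<Lambda>"
    unfolding S_def T_def by (rule cuntz_family_permutative[OF A rep perm])
  note D = assms(4)
  have a: "a n = (F.recur ^^ (n - 1)) F.low" for n
    using boson_op_eq_recur[OF A rep perm] by (simp add: assms(5) S_def T_def fun_eq_iff)
  have adj: "cinner (a n w) v = cinner w ((F.recur ^^ (n - 1)) F.rais v)"
    if "w \<in> D" "v \<in> D" for n v w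
    using that F.funpow_recur_adjoint by (simp add: a D)
  have a': "a' n v = (F.recur ^^ (n - 1)) F.rais v" if "v \<in> D" for n v
    unfolding assms(6)
    by (rule adjoint_on_eqI[OF onb]) (use that adj in \<open>auto simp: D scaleC.span_base\<close>)
  have endo: "a n v \<in> D" "(F.recur ^^ n) F.rais v \<in> D" if "v \<in> D" for n v
    using that lin_endo_in[OF F.funpow_recur_endo[OF F.low_endo]]
      lin_endo_in[OF F.funpow_recur_endo[OF F.rais_endo]] by (auto simp: a D)
  have ccr: "a n (a' m v) - a' m (a n v) = (if n = m then v else 0)"
    if "n \<ge> 1" "m \<ge> 1" "v \<in> D" and cover: "n = m \<longrightarrow> \<Lambda> = (\<Union>i\<in>{1..}. f i ` \<Lambda>)" for n m v
  proof (cases "n = m")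
    case True
    have "\<exists>k\<ge>1. \<exists>y\<in>e ` \<Lambda>. x = S k y" if x: "x \<in> e ` \<Lambda>" for x
    proof -
      obtain z where z: "x = e z" "z \<in> \<Lambda>" using x by blast
      then obtain k y where "k \<ge> 1" "y \<in> \<Lambda>" "z = f k y" using cover True by blast
      moreover from this z perm have "x = S k (e y)" by (simp add: S_def permutative_def)
      ultimately show ?thesis by blast
    qed
    from F.funpow_recur_low_rais[OF this] that(3) True endo[OF that(3)] show ?thesis
      by (simp add: a') (simp add: a D)
  next
    case False
    \<comment> \<open>Truncated subtraction identifies 0 and 1, so positivity of the indices enters
      here.\<close>
    with that have "n - 1 \<noteq> m - 1" by linarith
    from F.funpow_recur_commute[OF F.weighted_shift_low F.weighted_shift_rais this]
    show ?thesis using that(3) False endo[OF that(3)] by (simp add: a') (simp add: a D)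
  qed
  have comm: "a n (a m v) = a m (a n v)" "a' n (a' m v) = a' m (a' n v)"
    if "n \<ge> 1" "m \<ge> 1" "v \<in> D" for n m v
  proof -
    \<comment> \<open>Equal exponents make this trivial, so no covering condition enters.\<close>
    have "(F.recur ^^ (n - 1)) P ((F.recur ^^ (m - 1)) P v) =
        (F.recur ^^ (m - 1)) P ((F.recur ^^ (n - 1)) P v)" if P: "F.weighted_shift P" for P
      using F.funpow_recur_commute[OF P P, of "n - 1" "m - 1"] \<open>v \<in> D\<close>
      by (cases "n - 1 = m - 1") (auto simp: D)
    from this[OF F.weighted_shift_low] this[OF F.weighted_shift_rais]
    show "a n (a m v) = a m (a n v)" "a' n (a' m v) = a' m (a' n v)"
      using that endo by (simp_all add: a' a)
  qed
  \<comment> \<open>This shows that \<open>a'\<close> is the genuine Hilbert space adjoint on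
    \<open>D\<close> and not an unspecified value of the description operator.\<close>
  have adjoint_exists: "\<exists>z\<in>D. \<forall>w\<in>D. cinner (a n w) v = cinner w z" if "v \<in> D" for n v
    using adj endo(2) that by blast
  show ?thesis
  proof (intro conjI allI ballI impI)
    fix n m :: nat and v
    assume "n \<ge> 1" "m \<ge> 1" "v \<in> D" "n = m \<longrightarrow> \<Lambda> = (\<Union>i\<in>{1..}. f i ` \<Lambda>)"
    then show "a n (a' m v) - a' m (a n v) = (if n = m then v else 0)" by (rule ccr)
  qed (simp_all only: endo(1) adjoint_exists comm diff_self)
qed

end
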